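(* Let $n\ge 1$, let $Q\in\mathbb{R}^{n\times n}$, let $f(x)=x^TQx\in\mathcal{H}_{n,2}$, and let $r\ge 1$ be an integer. Set $Q_{\max}=\max_{i\in\{1,\dots,n\}}Q_{ii}$. Then $$\max_{x\in\Delta_n}\{B_r(f)(x)-f(x)\}\le \frac{Q_{\max}-\underline{f}}{r}\le\frac{\overline{f}-\underline{f}}{r}.$$
   Context: $\mathbb{N}=\{0,1,2,\dots\}$. $\mathcal{H}_{n,d}$ is the set of homogeneous polynomials of degree $d$ in $n$ variables with real coefficients. The standard simplex is $\Delta_n=\{x\in\mathbb{R}_+^n:\sum_{i=1}^n x_i=1\}$; $\underline{f}=\min_{x\in\Delta_n}f(x)$ and $\overline{f}=\max_{x\in\Delta_n}f(x)$. For $r\ge 0$, $I(n,r)=\{\alpha\in\mathbb{N}^n:\sum_{i=1}^n\alpha_i=r\}$. For $\alpha\in\mathbb{N}^n$, $\alpha!=\prod_{i=1}^n\alpha_i!$ and $x^\alpha=\prod_{i=1}^n x_i^{\alpha_i}$ (with $0^0=1$). The Bernstein approximation of order $r\ge1$ on the simplex of a polynomial $f$ is the polynomial $$B_r(f)(x)=\sum_{\alpha\in I(n,r)}f\left(\frac{\alpha}{r}\right)\frac{r!}{\alpha!}x^\alpha.$$ *)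

theory Defs
  imports "HOL-Analysis.Analysis"
begin

text \<open>The dimension \<open>n \<ge> 1\<close> is \<open>CARD('n)\<close> for a finite index type \<open>'n\<close>.\<close>

definition std_simplex :: "(real ^ 'n::finite) set" where
  "std_simplex = {x. (\<forall>i. 0 \<le> x $ i) \<and> (\<Sum>i\<in>UNIV. x $ i) = 1}"

definition max_on :: "'a set \<Rightarrow> ('a \<Rightarrow> real) \<Rightarrow> real" where
  "max_on S g = (GREATEST v. v \<in> g ` S)"

definition min_on :: "'a set \<Rightarrow> ('a \<Rightarrow> real) \<Rightarrow> real" where
  "min_on S g = (LEAST v. v \<in> g ` S)"

definition multi_indices :: "nat \<Rightarrow> (nat ^ 'n::finite) set" where
  "multi_indices r = {\<alpha>. (\<Sum>i\<in>UNIV. \<alpha> $ i) = r}"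

definition multi_fact :: "nat ^ 'n::finite \<Rightarrow> real" where
  "multi_fact \<alpha> = (\<Prod>i\<in>UNIV. fact (\<alpha> $ i))"

definition multi_power :: "real ^ 'n::finite \<Rightarrow> nat ^ 'n \<Rightarrow> real" where
  "multi_power x \<alpha> = (\<Prod>i\<in>UNIV. (x $ i) ^ (\<alpha> $ i))"

definition bernstein_simplex ::
    "nat \<Rightarrow> (real ^ 'n::finite \<Rightarrow> real) \<Rightarrow> real ^ 'n \<Rightarrow> real" where
  "bernstein_simplex r f x =
     (\<Sum>\<alpha>\<in>multi_indices r.
        f (\<chi> i. real (\<alpha> $ i) / real r) * (fact r / multi_fact \<alpha>) * multi_power x \<alpha>)"

text \<open>The sum above ranges over a finite set, and the extrema of continuous
  functions on the simplex are attained, so none of these definitions takes a default value.\<close>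

lemma finite_multi_indices: "finite (multi_indices r :: (nat ^ 'n::finite) set)"
proof (rule finite_subset)
  show "(multi_indices r :: (nat ^ 'n) set) \<subseteq> vec_lambda ` (UNIV \<rightarrow>\<^sub>E {..r})"
  proof
    fix \<alpha> :: "nat ^ 'n"
    assume "\<alpha> \<in> multi_indices r"
    then have s: "(\<Sum>i\<in>UNIV. \<alpha> $ i) = r" by (simp add: multi_indices_def)
    have "\<alpha> $ i \<le> r" for i
      using member_le_sum[of i UNIV "\<lambda>i. \<alpha> $ i"] s by simp
    then have "vec_nth \<alpha> \<in> UNIV \<rightarrow>\<^sub>E {..r}" by auto
    then show "\<alpha> \<in> vec_lambda ` (UNIV \<rightarrow>\<^sub>E {..r})"
      by (metis image_eqI vec_nth_inverse)
  qed
  show "finite ((vec_lambda :: ('n \<Rightarrow> nat) \<Rightarrow> _) ` (UNIV \<rightarrow>\<^sub>E {..r}))"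
    by (intro finite_imageI finite_PiE) auto
qed

lemma compact_std_simplex: "compact (std_simplex :: (real ^ 'n::finite) set)"
proof -
  have "closed {x :: real ^ 'n. (\<forall>i. 0 \<le> x $ i) \<and> (\<Sum>i\<in>UNIV. x $ i) = 1}"
    by (intro closed_Collect_conj closed_Collect_all closed_Collect_le closed_Collect_eq
        continuous_intros)
  moreover have "norm x \<le> 1" if "x \<in> std_simplex" for x :: "real ^ 'n"
    using norm_le_l1_cart[of x] that by (simp add: std_simplex_def)
  then have "bounded (std_simplex :: (real ^ 'n) set)"
    by (auto simp: bounded_iff)
  ultimately show ?thesis
    by (simp add: compact_eq_bounded_closed std_simplex_def)
qed

lemma std_simplex_nonempty: "(std_simplex :: (real ^ 'n::finite) set) \<noteq> {}"
proof -
  have "axis k 1 \<in> std_simplex" for k :: 'n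
    by (simp add: std_simplex_def axis_def)
  then show ?thesis by blast
qed

lemma max_on_std_simplex:
  fixes g :: "real ^ 'n::finite \<Rightarrow> real"
  assumes "continuous_on std_simplex g"
  shows "max_on std_simplex g \<in> g ` std_simplex"
    and "\<And>x. x \<in> std_simplex \<Longrightarrow> g x \<le> max_on std_simplex g"
proof -
  obtain z where z: "z \<in> std_simplex" "\<forall>y\<in>std_simplex. g y \<le> g z"
    using continuous_attains_sup[OF compact_std_simplex std_simplex_nonempty assms] by blast
  then have "max_on std_simplex g = g z"
    unfolding max_on_def by (intro Greatest_equality) auto
  with z show "max_on std_simplex g \<in> g ` std_simplex"
    and "\<And>x. x \<in> std_simplex \<Longrightarrow> g x \<le> max_on std_simplex g" by auto
qed

lemma min_on_std_simplex:
  fixes g :: "real ^ 'n::finite \<Rightarrow> real"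
  assumes "continuous_on std_simplex g"
  shows "min_on std_simplex g \<in> g ` std_simplex"
    and "\<And>x. x \<in> std_simplex \<Longrightarrow> min_on std_simplex g \<le> g x"
proof -
  obtain z where z: "z \<in> std_simplex" "\<forall>y\<in>std_simplex. g z \<le> g y"
    using continuous_attains_inf[OF compact_std_simplex std_simplex_nonempty assms] by blast
  then have "min_on std_simplex g = g z"
    unfolding min_on_def by (intro Least_equality) auto
  with z show "min_on std_simplex g \<in> g ` std_simplex"
    and "\<And>x. x \<in> std_simplex \<Longrightarrow> min_on std_simplex g \<le> g x" by auto
qed

end

theory Submission
  imports Defs
begin

text \<open>
  The numbers \<open>(r! / \<alpha>!) x\<^sup>\<alpha>\<close> are the multinomial probabilities of \<open>r\<close> independent draws from the
  distribution \<open>x\<close> on the index set, so \<open>B\<^sub>r(f)(x)\<close> is the expectation of \<open>f\<close> at the vector of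
  empirical frequencies \<open>\<alpha> / r\<close>.  For a quadratic form, only second moments matter: that vector has
  mean \<open>x\<close> and covariance \<open>(diag(x) - x x\<^sup>T) / r\<close>, whence the exact formula
  \<open>B\<^sub>r(f)(x) - f(x) = (\<Sum>\<^sub>i Q\<^sub>i\<^sub>i x\<^sub>i - f(x)) / r\<close> of \<open>bernstein_error_quadratic_form\<close>.  The first
  bound follows because \<open>\<Sum>\<^sub>i Q\<^sub>i\<^sub>i x\<^sub>i\<close> is an average of diagonal entries, and the second because every
  \<open>Q\<^sub>i\<^sub>i\<close> is the value of \<open>f\<close> at a vertex of the simplex.

  All moments, including the total mass \<open>1\<close>, come from the single shift identity
  \<open>multinomial_sum_shift\<close>.
\<close>

definition multinomial_weight :: "nat \<Rightarrow> real ^ 'n::finite \<Rightarrow> nat ^ 'n \<Rightarrow> real" where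
  "multinomial_weight r x \<alpha> = fact r / multi_fact \<alpha> * multi_power x \<alpha>"

definition multinomial_sum :: "nat \<Rightarrow> real ^ 'n::finite \<Rightarrow> (nat ^ 'n \<Rightarrow> real) \<Rightarrow> real" where
  "multinomial_sum r x g = (\<Sum>\<alpha>\<in>multi_indices r. g \<alpha> * multinomial_weight r x \<alpha>)"

lemma bernstein_simplex_eq_multinomial_sum:
  "bernstein_simplex r f x = multinomial_sum r x (\<lambda>\<alpha>. f (\<chi> i. real (\<alpha> $ i) / real r))"
  by (simp add: bernstein_simplex_def multinomial_sum_def multinomial_weight_def mult.assoc)

lemma multinomial_sum_add:
  "multinomial_sum r x (\<lambda>\<alpha>. g \<alpha> + h \<alpha>) = multinomial_sum r x g + multinomial_sum r x h"
  by (simp add: multinomial_sum_def distrib_right sum.distrib)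

lemma multinomial_sum_cmult:
  "multinomial_sum r x (\<lambda>\<alpha>. c * g \<alpha>) = c * multinomial_sum r x g"
  by (simp add: multinomial_sum_def sum_distrib_left mult.assoc)

lemma multinomial_sum_sum:
  "multinomial_sum r x (\<lambda>\<alpha>. \<Sum>i\<in>A. g i \<alpha>) = (\<Sum>i\<in>A. multinomial_sum r x (g i))"
  unfolding multinomial_sum_def sum_distrib_right by (rule sum.swap)

lemma multinomial_sum_cong:
  assumes "\<And>\<alpha>. \<alpha> \<in> multi_indices r \<Longrightarrow> g \<alpha> = h \<alpha>"
  shows "multinomial_sum r x g = multinomial_sum r x h"
  unfolding multinomial_sum_def using assms by (intro sum.cong) auto

lemma sum_add_axis: "(\<Sum>j\<in>UNIV. (\<beta> + axis i 1 :: nat ^ 'n::finite) $ j) = Suc (\<Sum>j\<in>UNIV. \<beta> $ j)"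
  by (simp add: sum.distrib axis_def)

lemma multi_fact_add_axis:
  fixes \<beta> :: "nat ^ 'n::finite"
  shows "multi_fact (\<beta> + axis i 1) = real (Suc (\<beta> $ i)) * multi_fact \<beta>"
proof -
  have "(\<Prod>j\<in>UNIV - {i}. fact ((\<beta> + axis i 1) $ j) :: real) = (\<Prod>j\<in>UNIV - {i}. fact (\<beta> $ j))"
    by (intro prod.cong) (auto simp: axis_def)
  then show ?thesis
    by (simp add: multi_fact_def prod.remove[of UNIV i] axis_def algebra_simps)
qed

lemma multi_power_add_axis:
  fixes \<beta> :: "nat ^ 'n::finite"
  shows "multi_power x (\<beta> + axis i 1) = x $ i * multi_power x \<beta>"
proof -
  have "(\<Prod>j\<in>UNIV - {i}. (x $ j) ^ ((\<beta> + axis i 1) $ j)) = (\<Prod>j\<in>UNIV - {i}. (x $ j) ^ (\<beta> $ j))"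
    by (intro prod.cong) (auto simp: axis_def)
  then show ?thesis
    by (simp add: multi_power_def prod.remove[of UNIV i] axis_def algebra_simps)
qed

lemma multi_fact_pos: "multi_fact \<alpha> > 0"
  by (simp add: multi_fact_def prod_pos)

text \<open>The factor \<open>\<beta>\<^sub>i + 1\<close> cancels the one that \<open>multi_fact\<close> gains when the exponent \<open>\<beta>\<^sub>i\<close>
  is raised.\<close>

lemma multinomial_weight_add_axis:
  fixes \<beta> :: "nat ^ 'n::finite"
  shows "real (Suc (\<beta> $ i)) * multinomial_weight (Suc r) x (\<beta> + axis i 1)
         = real (Suc r) * x $ i * multinomial_weight r x \<beta>"
  using multi_fact_pos[of \<beta>]
  unfolding multinomial_weight_def multi_fact_add_axis multi_power_add_axis
  by (simp add: divide_simps del: of_nat_Suc)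

text \<open>Only the terms with \<open>\<alpha>\<^sub>i \<noteq> 0\<close> survive in a sum weighted by \<open>\<alpha>\<^sub>i\<close>; this reindexes them by
  multi-indices of the next lower order.\<close>

lemma image_add_axis_multi_indices:
  fixes i :: "'n::finite"
  shows "(\<lambda>\<beta>. \<beta> + axis i 1) ` multi_indices r = {\<alpha> \<in> multi_indices (Suc r). \<alpha> $ i \<noteq> 0}"
    (is "?L = ?R")
proof (intro equalityI subsetI)
  fix \<alpha> assume "\<alpha> \<in> ?L"
  then obtain \<beta> where \<beta>: "\<beta> \<in> multi_indices r" and \<alpha>: "\<alpha> = \<beta> + axis i 1" by blast
  have "\<alpha> $ i \<noteq> 0" by (simp add: \<alpha>)
  moreover have "\<alpha> \<in> multi_indices (Suc r)"
    using \<beta> sum_add_axis[of \<beta> i] unfolding \<alpha> multi_indices_def by (simp only: mem_Collect_eq)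
  ultimately show "\<alpha> \<in> ?R" by simp
next
  fix \<alpha> assume \<alpha>: "\<alpha> \<in> ?R"
  define \<beta> where "\<beta> = (\<chi> j. if j = i then \<alpha> $ i - 1 else \<alpha> $ j)"
  have eq: "\<alpha> = \<beta> + axis i 1"
    using \<alpha> by (simp add: \<beta>_def axis_def vec_eq_iff)
  then have "\<beta> \<in> multi_indices r"
    using \<alpha> sum_add_axis[of \<beta> i] by (simp add: multi_indices_def del: vector_add_component)
  with eq show "\<alpha> \<in> ?L" by blast
qed

text \<open>Weighting by \<open>\<alpha>\<^sub>i\<close> amounts to singling out one of the \<open>r + 1\<close> draws that produced the
  index \<open>i\<close>: that draw contributes the probability \<open>x\<^sub>i\<close>, and the other \<open>r\<close> draws remain
  multinomial.  Hence each factor \<open>\<alpha>\<^sub>i\<close> can be traded for a decrease of the order by one.\<close>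

lemma multinomial_sum_shift:
  fixes x :: "real ^ 'n::finite"
  shows "multinomial_sum (Suc r) x (\<lambda>\<alpha>. real (\<alpha> $ i) * g \<alpha>)
         = real (Suc r) * x $ i * multinomial_sum r x (\<lambda>\<beta>. g (\<beta> + axis i 1))"
proof -
  let ?t = "\<lambda>\<alpha>. real (\<alpha> $ i) * g \<alpha> * multinomial_weight (Suc r) x \<alpha>"
  have "multinomial_sum (Suc r) x (\<lambda>\<alpha>. real (\<alpha> $ i) * g \<alpha>)
        = sum ?t {\<alpha> \<in> multi_indices (Suc r). \<alpha> $ i \<noteq> 0}"
    unfolding multinomial_sum_def
    by (intro sum.mono_neutral_right) (auto simp: finite_multi_indices)
  also have "\<dots> = (\<Sum>\<beta>\<in>multi_indices r. ?t (\<beta> + axis i 1))"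
    unfolding image_add_axis_multi_indices[symmetric]
    by (subst sum.reindex) (auto simp: inj_on_def)
  also have "\<dots> = (\<Sum>\<beta>\<in>multi_indices r.
      real (Suc r) * x $ i * (g (\<beta> + axis i 1) * multinomial_weight r x \<beta>))"
  proof (rule sum.cong[OF refl])
    fix \<beta> :: "nat ^ 'n"
    have "?t (\<beta> + axis i 1) = g (\<beta> + axis i 1) *
        (real (Suc (\<beta> $ i)) * multinomial_weight (Suc r) x (\<beta> + axis i 1))"
      by (simp add: axis_def)
    then show "?t (\<beta> + axis i 1)
        = real (Suc r) * x $ i * (g (\<beta> + axis i 1) * multinomial_weight r x \<beta>)"
      unfolding multinomial_weight_add_axis by (simp only: mult_ac)
  qed
  finally show ?thesis
    by (simp only: multinomial_sum_def sum_distrib_left)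
qed

text \<open>The total mass is the sum of the shift identities over \<open>i\<close>, since the entries of a
  multi-index of order \<open>r + 1\<close> add up to \<open>r + 1\<close>.\<close>

lemma multinomial_sum_one:
  assumes x: "(\<Sum>i\<in>UNIV. x $ i) = 1"
  shows "multinomial_sum r x (\<lambda>_. 1) = 1"
proof (induction r)
  case 0
  have "multi_indices 0 = {0 :: nat ^ 'a}"
    by (auto simp: multi_indices_def vec_eq_iff)
  then show ?case
    by (simp add: multinomial_sum_def multinomial_weight_def multi_fact_def multi_power_def)
next
  case (Suc r)
  have "real (Suc r) * multinomial_sum (Suc r) x (\<lambda>_. 1)
        = multinomial_sum (Suc r) x (\<lambda>\<alpha>. \<Sum>i\<in>UNIV. real (\<alpha> $ i) * 1)"
    unfolding multinomial_sum_cmult[symmetric]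
    by (intro multinomial_sum_cong)
       (simp add: multi_indices_def flip: of_nat_sum)
  also have "\<dots> = (\<Sum>i\<in>UNIV. real (Suc r) * x $ i)"
    unfolding multinomial_sum_sum multinomial_sum_shift Suc.IH by simp
  also have "\<dots> = real (Suc r)"
    unfolding sum_distrib_left[symmetric] x by simp
  finally show ?case by (simp del: of_nat_Suc)
qed

lemma multinomial_sum_mean:
  assumes x: "(\<Sum>i\<in>UNIV. x $ i) = 1"
  shows "multinomial_sum r x (\<lambda>\<alpha>. real (\<alpha> $ i)) = real r * x $ i"
proof (cases r)
  case 0
  then show ?thesis
    by (simp add: multinomial_sum_def multi_indices_def)
next
  case (Suc m)
  then show ?thesis
    using multinomial_sum_shift[of m x i "\<lambda>_. 1"] multinomial_sum_one[OF x, of m] by simp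
qed

lemma multinomial_sum_second_moment:
  assumes x: "(\<Sum>i\<in>UNIV. x $ i) = 1"
  shows "multinomial_sum (Suc m) x (\<lambda>\<alpha>. real (\<alpha> $ i) * real (\<alpha> $ j))
         = real (Suc m) * x $ i * (real m * x $ j + (if i = j then 1 else 0))"
proof -
  have "multinomial_sum m x (\<lambda>\<beta>. real ((\<beta> + axis i 1) $ j))
        = multinomial_sum m x (\<lambda>\<beta>. real (\<beta> $ j) + (if i = j then 1 else 0) * 1)"
    by (intro multinomial_sum_cong) (auto simp: axis_def)
  also have "\<dots> = real m * x $ j + (if i = j then 1 else 0)"
    unfolding multinomial_sum_add multinomial_sum_cmult
    by (simp add: multinomial_sum_mean[OF x] multinomial_sum_one[OF x])
  finally show ?thesis
    unfolding multinomial_sum_shift by simp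
qed

lemma quadratic_form_eq_sum:
  fixes Q :: "real ^ 'n::finite ^ 'n"
  shows "x \<bullet> (Q *v x) = (\<Sum>i\<in>UNIV. \<Sum>j\<in>UNIV. Q $ i $ j * (x $ i * x $ j))"
  by (simp add: inner_vec_def matrix_vector_mult_def sum_distrib_left mult_ac)

text \<open>The diagonal of \<open>Q\<close> enters through the case \<open>i = j\<close> of the second moments: of the \<open>r\<^sup>2\<close>
  ordered pairs of draws, \<open>r\<close> consist of one draw taken twice, and these show the index \<open>i\<close> in both
  places with probability \<open>x\<^sub>i\<close> instead of \<open>x\<^sub>i\<^sup>2\<close>.\<close>

lemma bernstein_error_quadratic_form:
  fixes Q :: "real ^ 'n::finite ^ 'n"
  assumes r: "r \<ge> 1" and x: "(\<Sum>i\<in>UNIV. x $ i) = 1"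
  shows "bernstein_simplex r (\<lambda>y. y \<bullet> (Q *v y)) x - x \<bullet> (Q *v x)
         = ((\<Sum>i\<in>UNIV. Q $ i $ i * x $ i) - x \<bullet> (Q *v x)) / real r"
proof -
  obtain m where m: "r = Suc m" using r by (cases r) auto
  have "bernstein_simplex r (\<lambda>y. y \<bullet> (Q *v y)) x
      = multinomial_sum r x (\<lambda>\<alpha>. \<Sum>i\<in>UNIV. \<Sum>j\<in>UNIV.
          Q $ i $ j / (real r)\<^sup>2 * (real (\<alpha> $ i) * real (\<alpha> $ j)))"
    unfolding bernstein_simplex_eq_multinomial_sum quadratic_form_eq_sum
    by (simp add: power2_eq_square)
  also have "\<dots> = (\<Sum>i\<in>UNIV. \<Sum>j\<in>UNIV. Q $ i $ j / (real r)\<^sup>2 *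
      (real r * x $ i * (real m * x $ j + (if i = j then 1 else 0))))"
    unfolding multinomial_sum_sum multinomial_sum_cmult m
      multinomial_sum_second_moment[OF x] ..
  also have "\<dots> = (\<Sum>i\<in>UNIV. \<Sum>j\<in>UNIV. real m / real r * (Q $ i $ j * (x $ i * x $ j))
      + (if i = j then Q $ i $ i * x $ i / real r else 0))"
    using r by (intro sum.cong refl) (auto simp: field_simps power2_eq_square)
  also have "\<dots> = real m / real r * (x \<bullet> (Q *v x)) + (\<Sum>i\<in>UNIV. Q $ i $ i * x $ i) / real r"
    by (simp add: sum.distrib quadratic_form_eq_sum sum_distrib_left sum_divide_distrib)
  also have "real m / real r = 1 - 1 / real r"
    by (simp add: m field_simps)
  finally show ?thesis
    by (simp add: left_diff_distrib diff_divide_distrib)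
qed

lemma continuous_on_quadratic_form:
  fixes Q :: "real ^ 'n::finite ^ 'n"
  shows "continuous_on S (\<lambda>x. x \<bullet> (Q *v x))"
  unfolding quadratic_form_eq_sum by (intro continuous_intros)

lemma continuous_on_bernstein_simplex: "continuous_on S (bernstein_simplex r f)"
  unfolding bernstein_simplex_def multi_power_def by (intro continuous_intros)

lemma axis_in_std_simplex: "axis i 1 \<in> std_simplex"
  by (simp add: std_simplex_def axis_def)

lemma quadratic_form_axis:
  fixes Q :: "real ^ 'n::finite ^ 'n"
  shows "axis i 1 \<bullet> (Q *v axis i 1) = Q $ i $ i"
  by (simp add: inner_axis' matrix_vector_mult_basis column_def)

theorem theorem4:
  fixes Q :: "real ^ 'n::finite ^ 'n"
    and f :: "real ^ 'n \<Rightarrow> real"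
    and r :: nat
    and Qmax :: real
  assumes f: "f = (\<lambda>x. x \<bullet> (Q *v x))"
    and r: "r \<ge> 1"
    and Qmax: "Qmax = Max (range (\<lambda>i. Q $ i $ i))"
  shows "max_on std_simplex (\<lambda>x. bernstein_simplex r f x - f x)
           \<le> (Qmax - min_on std_simplex f) / real r
       \<and> (Qmax - min_on std_simplex f) / real r
           \<le> (max_on std_simplex f - min_on std_simplex f) / real r"
proof
  have cont: "continuous_on std_simplex f"
    unfolding f by (rule continuous_on_quadratic_form)
  have "continuous_on std_simplex (\<lambda>x. bernstein_simplex r f x - f x)"
    by (intro continuous_on_diff continuous_on_bernstein_simplex cont)
  from max_on_std_simplex(1)[OF this] obtain x where x: "x \<in> std_simplex"
    and max: "max_on std_simplex (\<lambda>x. bernstein_simplex r f x - f x)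
              = bernstein_simplex r f x - f x"
    by blast
  have x1: "(\<Sum>i\<in>UNIV. x $ i) = 1" and x0: "0 \<le> x $ i" for i
    using x by (auto simp: std_simplex_def)
  have "(\<Sum>i\<in>UNIV. Q $ i $ i * x $ i) \<le> (\<Sum>i\<in>UNIV. Qmax * x $ i)"
    unfolding Qmax by (intro sum_mono mult_right_mono x0 Max_ge) auto
  also have "\<dots> = Qmax"
    by (simp add: x1 flip: sum_distrib_left)
  finally have "(\<Sum>i\<in>UNIV. Q $ i $ i * x $ i) - f x \<le> Qmax - min_on std_simplex f"
    using min_on_std_simplex(2)[OF cont x] by linarith
  then show "max_on std_simplex (\<lambda>x. bernstein_simplex r f x - f x)
             \<le> (Qmax - min_on std_simplex f) / real r"
    unfolding max using bernstein_error_quadratic_form[OF r x1, of Q]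
    by (simp add: f divide_right_mono)
next
  have "Qmax \<in> range (\<lambda>i. Q $ i $ i)"
    unfolding Qmax by (rule Max_in) auto
  then obtain i where "Qmax = Q $ i $ i" by blast
  then have "Qmax = f (axis i 1)"
    by (simp add: f quadratic_form_axis)
  also have "\<dots> \<le> max_on std_simplex f"
    unfolding f by (intro max_on_std_simplex(2) continuous_on_quadratic_form axis_in_std_simplex)
  finally show "(Qmax - min_on std_simplex f) / real r
                \<le> (max_on std_simplex f - min_on std_simplex f) / real r"
    by (intro divide_right_mono) auto
qed

end
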